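(* Let $(T,d)$ be a metric space and $m$ a Borel probability measure on $T$ with $\operatorname{supp}(m)=T$. Let $a,b\ge0$, let $\varphi\in\mathcal{G}_{a,b}$ be a Young function, and let $R\ge 2$. Put $A=\frac{R^3}{(R-1)(R-2)}$ and $B=\frac{R^2}{R-1}$. Then for each separable real-valued stochastic process $X(t)$, $t\in T$, which satisfies $$\sup_{s,t\in T}\mathbf{E}\,\varphi\left(\frac{|X(s)-X(t)|}{d(s,t)}\right)\le 1,$$ the following inequality holds: $$\mathbf{E}\sup_{s,t\in T}|X(s)-X(t)|\le 2aA\,\mathcal{S}+2bB\,\bar{\mathcal{S}}.$$
   Context: $B(x,\varepsilon)=\{y\in T:d(x,y)\le\varepsilon\}$ is the closed ball and $D(T)=\sup\{d(s,t):s,t\in T\}$ the diameter of $T$ (possibly $+\infty$). A Young function is a (strictly) increasing convex function $\varphi:\mathbb{R}_+\to\mathbb{R}$ with $\varphi(0)=0$. For $a,b\ge0$, $\mathcal{G}_{a,b}$ is the class of all functions $\varphi:\mathbb{R}_+\to\mathbb{R}$ that are (strictly) increasing and continuous, satisfy $\varphi(0)=0$, and satisfy $x\le a+b\frac{\varphi(xy)}{\varphi(y)}$ for all $x\ge 0$, $y\ge\varphi^{-1}(1)$; it is understood that the inverse $\varphi^{-1}$ is defined on $[0,\infty)$. Define $\sigma(x)=\int_0^{D(T)}\varphi^{-1}\left(\frac{1}{m(B(x,\varepsilon))}\right)d\varepsilon\in[0,\infty]$, $\bar{\mathcal{S}}=\int_T\sigma(u)\,m(du)\in[0,\infty]$ and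 $\mathcal{S}=\sup_{x\in T}\sigma(x)\in[0,\infty]$. Conventions: $0/0=0$ (so the terms with $s=t$ contribute $\varphi(0)=0$); for $R=2$, $A=+\infty$; and $0\cdot\infty=0$. For a separable process, expectations of suprema over $T$ are understood as suprema over finite subsets: $\mathbf{E}\sup_{s,t\in T}|X(s)-X(t)|:=\sup_{F\subset T,\ F\text{ finite}}\mathbf{E}\sup_{s,t\in F}|X(s)-X(t)|$. *)

theory Defs
  imports "HOL-Probability.Probability"
begin

text \<open>
  The metric space is a type of class \<open>metric_space\<close>.  Functions on the half-line are modelled as
  functions \<open>real \<Rightarrow> real\<close> of which only the values on \<open>{0..}\<close> matter.
\<close>

definition msupport :: "'t::topological_space measure \<Rightarrow> 't set" where
  "msupport m = {x. \<forall>U. open U \<longrightarrow> x \<in> U \<longrightarrow> emeasure m U > 0}"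

definition ediam :: "'t::metric_space set \<Rightarrow> ennreal" where
  "ediam T = (SUP s\<in>T. SUP t\<in>T. ennreal (dist s t))"

definition young_function :: "(real \<Rightarrow> real) \<Rightarrow> bool" where
  "young_function \<phi> \<longleftrightarrow> strict_mono_on {0..} \<phi> \<and> convex_on {0..} \<phi> \<and> \<phi> 0 = 0"

abbreviation inv_pos :: "(real \<Rightarrow> real) \<Rightarrow> real \<Rightarrow> real" where
  "inv_pos \<phi> \<equiv> inv_into {0..} \<phi>"

text \<open>
  The condition \<open>\<phi> ` {0..} = {0..}\<close> says that the inverse function is defined on all of \<open>{0..}\<close>.
\<close>

definition G_class :: "real \<Rightarrow> real \<Rightarrow> (real \<Rightarrow> real) set" where
  "G_class a b = {\<phi>. strict_mono_on {0..} \<phi> \<and> continuous_on {0..} \<phi> \<and> \<phi> 0 = 0 \<and> \<phi> ` {0..} = {0..} \<and>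
     (\<forall>x\<ge>0. \<forall>y\<ge>inv_pos \<phi> 1. x \<le> a + b * (\<phi> (x * y) / \<phi> y))}"

definition mm_sigma :: "(real \<Rightarrow> real) \<Rightarrow> 't::metric_space measure \<Rightarrow> 't \<Rightarrow> ennreal" where
  "mm_sigma \<phi> m x =
     (\<integral>\<^sup>+\<epsilon>\<in>{\<epsilon>. 0 < \<epsilon> \<and> ennreal \<epsilon> < ediam (UNIV :: 't set)}.
        ennreal (inv_pos \<phi> (1 / measure m (cball x \<epsilon>))) \<partial>lborel)"

definition mm_mean :: "(real \<Rightarrow> real) \<Rightarrow> 't::metric_space measure \<Rightarrow> ennreal" where
  "mm_mean \<phi> m = (\<integral>\<^sup>+u. mm_sigma \<phi> m u \<partial>m)"

definition mm_sup :: "(real \<Rightarrow> real) \<Rightarrow> 't::metric_space measure \<Rightarrow> ennreal" where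
  "mm_sup \<phi> m = (SUP x. mm_sigma \<phi> m x)"

text \<open>
  Separability in the sense of Doob: almost every path is determined by its values on one fixed
  countable set.
\<close>

definition separable_process :: "'w measure \<Rightarrow> ('t::metric_space \<Rightarrow> 'w \<Rightarrow> real) \<Rightarrow> bool" where
  "separable_process P X \<longleftrightarrow> (\<exists>D. countable D \<and>
     (AE \<omega> in P. \<forall>t. \<forall>\<epsilon>>0. X t \<omega> \<in> closure ((\<lambda>s. X s \<omega>) ` (D \<inter> ball t \<epsilon>))))"

text \<open>
  The expectation of the supremum over the whole index set is, by convention, the supremum of the
  expectations over finite subsets.
\<close>

definition expected_sup_increment :: "'w measure \<Rightarrow> ('t \<Rightarrow> 'w \<Rightarrow> real) \<Rightarrow> ennreal" where
  "expected_sup_increment P X =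
     (SUP F\<in>{F. finite F}. \<integral>\<^sup>+\<omega>. (SUP s\<in>F. SUP t\<in>F. ennreal \<bar>X s \<omega> - X t \<omega>\<bar>) \<partial>P)"

definition const_A :: "real \<Rightarrow> ennreal" where
  "const_A R = (if R = 2 then \<infinity> else ennreal (R ^ 3 / ((R - 1) * (R - 2))))"

definition const_B :: "real \<Rightarrow> ennreal" where
  "const_B R = ennreal (R\<^sup>2 / (R - 1))"

end

theory Submission
  imports Defs
begin

text \<open>
  Put \<open>y k = \<phi>\<^sup>-\<^sup>1(1) R^k\<close>, let \<open>r k x\<close> be the least radius at which \<open>m(B(x, r)) \<ge> 1/\<phi>(y k)\<close>
  (and \<open>r 0 = D(T)\<close>), and let \<open>S k f x\<close> be the mean of \<open>f\<close> over \<open>B(x, r k x)\<close>. Comparing \<open>f\<close> with its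
  global mean \<open>S 0 f\<close> through the compositions \<open>S n S (n-1) \<dots> S k f\<close> leaves increments
  \<open>|f u - f v|\<close> with \<open>d u v \<le> r k u\<close>. The growth condition at \<open>y (k+1)\<close> splits such an increment into
  \<open>a y (k+1) r k u\<close> and \<open>b y (k+1) r k u \<phi>(|f u - f v| / d u v) / \<phi>(y (k+1))\<close>; in the second part the
  denominator pays for enlarging the average over \<open>B(x, r (k+1) x)\<close> to an integral over the whole
  space, so it no longer depends on the starting point. As \<open>r k\<close> is 1-Lipschitz, averaging the first
  parts at most doubles their Lipschitz constants, and \<open>R > 2\<close> makes the resulting series geometric.
  Both sums are controlled by \<open>\<Sum>k. y (k+1) r k x \<le> B \<sigma>(x)\<close>.

  The process need not have measurable paths. It is Lipschitz in \<open>L\<^sup>1\<close> and the index space is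
  separable, so it has a jointly measurable modification; pathwise continuity is replaced by
  convergence of \<open>S n X x\<close> to \<open>X x\<close> in \<open>L\<^sup>1\<close>. All oscillations are integrals of absolute values in
  \<open>[0, \<infinity>]\<close>, so no integrability of paths is needed.
\<close>

section \<open>Measurability\<close>

lemma measurable_dist_left[measurable]:
  "(\<lambda>x. dist x c) \<in> borel_measurable borel"
  by (intro borel_measurable_continuous_onI continuous_intros)

lemma measurable_dist_right[measurable]:
  "(\<lambda>x. dist c x) \<in> borel_measurable borel"
  by (intro borel_measurable_continuous_onI continuous_intros)

lemma borel_measurable_lipschitz:
  fixes g :: "'t::metric_space \<Rightarrow> real"
  assumes "\<And>x u. g x \<le> g u + dist x u"
  shows "g \<in> borel_measurable borel"
proof -
  have "\<bar>g x - g u\<bar> \<le> dist x u" for x u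
    using assms[of x u] assms[of u x] by (simp add: dist_commute abs_le_iff)
  then have "1-lipschitz_on UNIV g"
    by (intro lipschitz_onI) (auto simp: dist_real_def)
  then show ?thesis by (intro borel_measurable_continuous_onI lipschitz_on_continuous_on)
qed

text \<open>
  The type carries no countability assumption, so the distance is not known to be measurable for the
  product \<open>\<sigma>\<close>-algebra until a countable dense sequence is supplied.
\<close>

lemma measurable_dist_pair:
  fixes q :: "nat \<Rightarrow> 't::metric_space"
  assumes dense: "\<And>t \<epsilon>. 0 < \<epsilon> \<Longrightarrow> \<exists>i. dist t (q i) < \<epsilon>"
  shows "(\<lambda>p::'t \<times> 't. dist (fst p) (snd p)) \<in> borel_measurable (borel \<Otimes>\<^sub>M borel)"
proof -
  \<comment> \<open>A countable infimum of sums of functions of one coordinate each.\<close>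
  have "dist x y = (INF i. dist x (q i) + dist (q i) y)" for x y :: 't
  proof (rule antisym)
    show "dist x y \<le> (INF i. dist x (q i) + dist (q i) y)"
      by (rule cINF_greatest) (auto intro: dist_triangle)
    show "(INF i. dist x (q i) + dist (q i) y) \<le> dist x y"
    proof (rule field_le_epsilon)
      fix e :: real assume "0 < e"
      then obtain i where i: "dist x (q i) < e / 2" using dense[of "e/2" x] by auto
      have "(INF i. dist x (q i) + dist (q i) y) \<le> dist x (q i) + dist (q i) y"
        by (rule cINF_lower) (auto intro!: bdd_belowI[of _ 0])
      also have "\<dots> \<le> dist x y + e"
        using i dist_triangle[of "q i" y x] by (simp add: dist_commute)
      finally show "(INF i. dist x (q i) + dist (q i) y) \<le> dist x y + e" .
    qed
  qed
  then have eq: "(\<lambda>p::'t \<times> 't. dist (fst p) (snd p))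
      = (\<lambda>p. INF i. dist (fst p) (q i) + dist (q i) (snd p))" by (intro ext)
  show ?thesis unfolding eq
  proof (rule borel_measurable_cINF)
    fix i
    show "(\<lambda>p. dist (fst p) (q i) + dist (q i) (snd p)) \<in> borel_measurable (borel \<Otimes>\<^sub>M borel)"
      by measurable
  qed (auto intro!: bdd_belowI[of _ 0])
qed

text \<open>Replacing t by the first \<open>q i\<close> within \<open>(1/2)^n\<close> of it leaves
  only countably many random variables, so \<open>Z n\<close> is jointly measurable; its summable
  \<open>L^1\<close> errors make it converge almost surely.\<close>

lemma jointly_measurable_modification:
  fixes X :: "'t::metric_space \<Rightarrow> 'w \<Rightarrow> real"
    and q :: "nat \<Rightarrow> 't"
  assumes dense: "\<And>t \<epsilon>. 0 < \<epsilon> \<Longrightarrow> \<exists>i. dist t (q i) < \<epsilon>"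
    and meas[measurable]: "\<And>t. X t \<in> borel_measurable P"
    and lip: "\<And>s t. (\<integral>\<^sup>+\<omega>. ennreal \<bar>X s \<omega> - X t \<omega>\<bar> \<partial>P) \<le> ennreal (C * dist s t)"
    and "0 \<le> C"
  obtains Y where "(\<lambda>p. Y (fst p) (snd p)) \<in> borel_measurable (borel \<Otimes>\<^sub>M P)"
    and "\<And>t. AE \<omega> in P. Y t \<omega> = X t \<omega>"
proof
  define j where "j n t = (LEAST i. dist t (q i) < (1/2) ^ n)" for n :: nat and t
  define Z where "Z n t = X (q (j n t))" for n :: nat and t
  \<comment> \<open>Where the sequence diverges, \<open>lim\<close> takes an arbitrary default; for
    each t this happens only on a null set.\<close>
  define Y where "Y t \<omega> = lim (\<lambda>n. Z n t \<omega>)" for t \<omega>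
  have j: "dist t (q (j n t)) < (1/2) ^ n" for n t
    unfolding j_def using dense[of "(1/2)^n" t] by (auto intro: LeastI)
  have [measurable]: "j n \<in> borel \<rightarrow>\<^sub>M count_space UNIV" for n
    unfolding j_def by measurable
  have Zm: "(\<lambda>p. Z n (fst p) (snd p)) \<in> borel_measurable (borel \<Otimes>\<^sub>M P)" for n
    unfolding Z_def
    by (rule measurable_compose_countable[where f = "\<lambda>i p. X (q i) (snd p)" and g = "\<lambda>p. j n (fst p)"]) measurable
  then show "(\<lambda>p. Y (fst p) (snd p)) \<in> borel_measurable (borel \<Otimes>\<^sub>M P)"
    unfolding Y_def by (intro borel_measurable_lim_metric)
  fix t
  have "(\<integral>\<^sup>+\<omega>. (\<Sum>n. ennreal \<bar>Z n t \<omega> - X t \<omega>\<bar>) \<partial>P) = (\<Sum>n. \<integral>\<^sup>+\<omega>. ennreal \<bar>Z n t \<omega> - X t \<omega>\<bar> \<partial>P)"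
    unfolding Z_def by (rule nn_integral_suminf) measurable
  also have "\<dots> \<le> (\<Sum>n. ennreal (C * (1/2) ^ n))"
  proof (rule suminf_le)
    show "(\<integral>\<^sup>+\<omega>. ennreal \<bar>Z n t \<omega> - X t \<omega>\<bar> \<partial>P) \<le> ennreal (C * (1/2) ^ n)" for n
      unfolding Z_def using j[of t n] \<open>0 \<le> C\<close>
      by (intro order_trans[OF lip]) (auto intro!: ennreal_leI mult_left_mono simp: dist_commute)
  qed auto
  also have "\<dots> < \<infinity>"
    using \<open>0 \<le> C\<close> by (subst suminf_ennreal2) (auto intro!: summable_mult summable_geometric)
  finally have "AE \<omega> in P. (\<Sum>n. ennreal \<bar>Z n t \<omega> - X t \<omega>\<bar>) \<noteq> \<infinity>"
    unfolding Z_def by (intro nn_integral_noteq_infinite) simp_all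
  then show "AE \<omega> in P. Y t \<omega> = X t \<omega>"
  proof (eventually_elim)
    case (elim \<omega>)
    then have "summable (\<lambda>n. \<bar>Z n t \<omega> - X t \<omega>\<bar>)"
      by (intro summable_suminf_not_top) simp_all
    then have "(\<lambda>n. Z n t \<omega> - X t \<omega>) \<longlonglongrightarrow> 0"
      by (rule tendsto_rabs_zero_cancel[OF summable_LIMSEQ_zero])
    then have "(\<lambda>n. Z n t \<omega>) \<longlonglongrightarrow> X t \<omega>" by (simp add: LIM_zero_iff)
    then show ?case unfolding Y_def by (rule limI)
  qed
qed

section \<open>Radii of balls of given mass\<close>

text \<open>A generalized inverse of the map from radius to mass. \<open>Inf\<close> of the empty
  set is unspecified, hence the radius \<epsilon> of sufficient mass that several facts below ask
  for.\<close>

definition mass_radius :: "'t::metric_space measure \<Rightarrow> real \<Rightarrow> 't \<Rightarrow> real" where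
  "mass_radius m c x = Inf {\<epsilon>. 0 \<le> \<epsilon> \<and> c \<le> measure m (cball x \<epsilon>)}"

lemma mass_radius_le:
  assumes "0 \<le> \<epsilon>" "c \<le> measure m (cball x \<epsilon>)"
  shows "mass_radius m c x \<le> \<epsilon>"
  unfolding mass_radius_def using assms by (intro cInf_lower) (auto intro!: bdd_belowI[of _ 0])

lemma mass_radius_nonneg:
  assumes "0 \<le> \<epsilon>" "c \<le> measure m (cball x \<epsilon>)"
  shows "0 \<le> mass_radius m c x"
  unfolding mass_radius_def using assms by (intro cInf_greatest) auto

lemma mass_radius_less:
  assumes "0 \<le> \<epsilon>" "\<epsilon> < mass_radius m c x"
  shows "measure m (cball x \<epsilon>) < c"
  using mass_radius_le[of \<epsilon> c m x] assms by linarith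

text \<open>Closed balls of radius \<open>?r + 1 / Suc n\<close> have mass at least c and decrease
  to the one of radius \<open>?r\<close>; by continuity from above the infimum is attained.\<close>

lemma measure_cball_mass_radius:
  fixes M :: "'t::metric_space measure"
  assumes "finite_measure M" and sets: "sets M = sets borel"
    and ne: "0 \<le> \<epsilon>" "c \<le> measure M (cball x \<epsilon>)"
  shows "c \<le> measure M (cball x (mass_radius M c x))"
proof -
  interpret finite_measure M by fact
  let ?r = "mass_radius M c x"
  let ?A = "\<lambda>n::nat. cball x (?r + 1 / Suc n)"
  have [simp]: "cball x e \<in> sets M" for e by (simp add: sets)
  have ge: "c \<le> measure M (?A n)" for n
  proof -
    have "\<exists>e\<in>{e. 0 \<le> e \<and> c \<le> measure M (cball x e)}. e < ?r + 1 / Suc n"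
      using ne unfolding mass_radius_def by (intro cInf_lessD) auto
    then obtain e where "c \<le> measure M (cball x e)" "e < ?r + 1 / Suc n" by auto
    then show ?thesis
      by (meson finite_measure_mono subset_cball less_imp_le order_trans \<open>\<And>e. cball x e \<in> sets M\<close>)
  qed
  have lim: "(\<lambda>n. measure M (?A n)) \<longlonglongrightarrow> measure M (\<Inter>n. ?A n)"
  proof (rule finite_Lim_measure_decseq)
    show "decseq ?A"
      unfolding decseq_def by (intro allI impI subset_cball add_left_mono divide_left_mono) auto
  qed auto
  have "(\<Inter>n. ?A n) = cball x ?r"
  proof (intro set_eqI iffI)
    fix z assume z: "z \<in> (\<Inter>n. ?A n)"
    have "(\<lambda>n. ?r + 1 / Suc n) \<longlonglongrightarrow> ?r + 0"
      by (intro tendsto_intros lim_const_over_n LIMSEQ_Suc[where f="\<lambda>n. 1 / real n"])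
    then have "dist x z \<le> ?r + 0" using z by (intro LIMSEQ_le_const) auto
    then show "z \<in> cball x ?r" by simp
  next
    fix z assume "z \<in> cball x ?r"
    then have "dist x z \<le> ?r + 1 / Suc n" for n by (simp add: add_increasing2)
    then show "z \<in> (\<Inter>n. ?A n)" by simp
  qed
  then show ?thesis using LIMSEQ_le_const[OF lim] ge by metis
qed

text \<open>The ball around z lies in the ball around x with radius enlarged by
  \<open>dist x z\<close>, so that radius competes in the infimum for x.\<close>

lemma mass_radius_lipschitz:
  fixes M :: "'t::metric_space measure"
  assumes "finite_measure M" and sets: "sets M = sets borel"
    and ne: "0 \<le> \<epsilon>" "c \<le> measure M (cball z \<epsilon>)"
  shows "mass_radius M c x \<le> mass_radius M c z + dist x z"
proof (rule mass_radius_le)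
  interpret finite_measure M by fact
  note nonneg = mass_radius_nonneg[OF ne]
  then show "0 \<le> mass_radius M c z + dist x z" by simp
  have "c \<le> measure M (cball z (mass_radius M c z))" by (rule measure_cball_mass_radius[OF assms(1) sets ne])
  also have "\<dots> \<le> measure M (cball x (mass_radius M c z + dist x z))"
  proof (rule finite_measure_mono)
    show "cball z (mass_radius M c z) \<subseteq> cball x (mass_radius M c z + dist x z)"
    proof
      fix u assume "u \<in> cball z (mass_radius M c z)"
      then show "u \<in> cball x (mass_radius M c z + dist x z)"
        using dist_triangle[of x u z] by simp
    qed
  qed (simp add: sets)
  finally show "c \<le> measure M (cball x (mass_radius M c z + dist x z))" .
qed

section \<open>Chaining along averaging kernels\<close>

text \<open>\<open>\<kappa> k x\<close> stands for the density of m normalized on the ball of radius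
  \<open>r k x\<close>. \<open>kernel_support\<close> keeps increments short,
  \<open>kernel_le\<close> lets a local average be dominated by a global integral,
  \<open>kernel_0\<close> makes stage 0 the global mean.\<close>

locale averaging_kernels = prob_space m
  for m :: "'t::metric_space measure" +
  fixes \<kappa> :: "nat \<Rightarrow> 't \<Rightarrow> 't \<Rightarrow> ennreal" and r :: "nat \<Rightarrow> 't \<Rightarrow> real" and \<phi> :: "real \<Rightarrow> real"
    and y :: "nat \<Rightarrow> real" and a b :: real
  assumes sets_m[measurable_cong]: "sets m = sets borel"
    and dist_measurable: "(\<lambda>p::'t \<times> 't. dist (fst p) (snd p)) \<in> borel_measurable (borel \<Otimes>\<^sub>M borel)"
    and kernel_measurable: "\<And>k. (\<lambda>p. \<kappa> k (fst p) (snd p)) \<in> borel_measurable (borel \<Otimes>\<^sub>M borel)"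
    and kernel_mass: "\<And>k x. (\<integral>\<^sup>+u. \<kappa> k x u \<partial>m) = 1"
    and kernel_0: "\<And>x u. \<kappa> 0 x u = 1"
    and kernel_support: "\<And>k x u. \<kappa> k x u \<noteq> 0 \<Longrightarrow> dist x u \<le> r k x"
    and kernel_le: "\<And>k x u. \<kappa> (Suc k) x u \<le> ennreal (\<phi> (y (Suc k)))"
    and r_nonneg: "\<And>k x. 0 \<le> r k x"
    and r_lipschitz: "\<And>k x u. r k x \<le> r k u + dist x u"
    and \<phi>_continuous: "continuous_on {0..} \<phi>"
    and \<phi>_nonneg: "\<And>q. 0 \<le> q \<Longrightarrow> 0 \<le> \<phi> q"
    and y_pos: "\<And>k. 0 < y k" and \<phi>_y_pos: "\<And>k. 0 < \<phi> (y k)"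
    and a_nonneg: "0 \<le> a" and b_nonneg: "0 \<le> b"
    and growth: "\<And>k q. 0 \<le> q \<Longrightarrow> q / y k \<le> a + b * (\<phi> q / \<phi> (y k))"
begin

lemma kernel_measurable'[measurable]:
  assumes [measurable]: "g \<in> N \<rightarrow>\<^sub>M borel" "h \<in> N \<rightarrow>\<^sub>M borel"
  shows "(\<lambda>z. \<kappa> k (g z) (h z)) \<in> borel_measurable N"
  using measurable_compose[OF _ kernel_measurable, of "\<lambda>z. (g z, h z)" N k] by simp

lemma dist_measurable'[measurable]:
  fixes g h :: "_ \<Rightarrow> 't"
  assumes [measurable]: "g \<in> N \<rightarrow>\<^sub>M borel" "h \<in> N \<rightarrow>\<^sub>M borel"
  shows "(\<lambda>z. dist (g z) (h z)) \<in> borel_measurable N"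
  using measurable_compose[OF _ dist_measurable, of "\<lambda>z. (g z, h z)" N] by simp

lemma r_measurable[measurable]: "r k \<in> borel_measurable borel"
  by (rule borel_measurable_lipschitz[OF r_lipschitz])

text \<open>\<phi> is continuous on the half-line only; precomposing with the absolute value extends
  it continuously to the line.\<close>

lemma \<phi>_measurable[measurable]:
  assumes [measurable]: "g \<in> borel_measurable N" "h \<in> N \<rightarrow>\<^sub>M borel" "h' \<in> N \<rightarrow>\<^sub>M borel"
  shows "(\<lambda>z. \<phi> (\<bar>g z\<bar> / dist (h z :: 't) (h' z))) \<in> borel_measurable N"
proof -
  have "continuous_on UNIV (\<lambda>q::real. \<phi> \<bar>q\<bar>)"
    by (rule continuous_on_compose2[OF \<phi>_continuous]) (auto intro!: continuous_intros)
  then have [measurable]: "(\<lambda>q::real. \<phi> \<bar>q\<bar>) \<in> borel_measurable borel"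
    by (rule borel_measurable_continuous_onI)
  have "(\<lambda>z. \<phi> \<bar>\<bar>g z\<bar> / dist (h z) (h' z)\<bar>) \<in> borel_measurable N" by measurable
  then show ?thesis by simp
qed

text \<open>Stands for the distance of \<open>f x\<close> from its k-th local mean; the absolute
  value inside keeps it meaningful for every path.\<close>

definition osc :: "('t \<Rightarrow> real) \<Rightarrow> nat \<Rightarrow> 't \<Rightarrow> ennreal" where
  "osc f k x = (\<integral>\<^sup>+u. \<kappa> k x u * ennreal \<bar>f x - f u\<bar> \<partial>m)"

text \<open>No starting point occurs here, so these terms leave the iterated averages as
  constants.\<close>

definition energy :: "('t \<Rightarrow> real) \<Rightarrow> nat \<Rightarrow> ennreal" where
  "energy f k = (\<integral>\<^sup>+x. ennreal (r k x) * (\<integral>\<^sup>+u. \<kappa> k x u * ennreal (\<phi> (\<bar>f x - f u\<bar> / dist x u)) \<partial>m) \<partial>m)"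

text \<open>
  \<open>lip n\<close> is a Lipschitz constant of \<open>maj n x + y (Suc n) * r n x\<close>; averaging such a function over the
  ball of radius \<open>r (Suc n) x\<close> costs \<open>lip n * r (Suc n) x\<close>, which is how \<open>maj (Suc n)\<close> arises.
\<close>

primrec lip :: "nat \<Rightarrow> real" where
  "lip 0 = y 1"
| "lip (Suc n) = 2 * lip n + y (Suc (Suc n))"

primrec maj :: "nat \<Rightarrow> 't \<Rightarrow> real" where
  "maj 0 x = 0"
| "maj (Suc n) x = maj n x + y (Suc n) * r n x + lip n * r (Suc n) x"

lemma lip_pos: "0 < lip n"
  by (induction n) (auto simp: y_pos intro!: add_pos_pos)

lemma maj_nonneg: "0 \<le> maj n x"
  by (induction n) (auto simp: r_nonneg y_pos lip_pos less_imp_le)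

lemma maj_measurable[measurable]: "maj n \<in> borel_measurable borel"
proof (induction n)
  case (Suc n)
  then have [measurable]: "maj n \<in> borel_measurable borel" .
  have "maj (Suc n) = (\<lambda>x. maj n x + y (Suc n) * r n x + lip n * r (Suc n) x)" by auto
  then show ?case by simp
next
  case 0
  have "maj 0 = (\<lambda>x. 0)" by auto
  then show ?case by simp
qed

text \<open>The term \<open>lip n * r (Suc n) x\<close> of \<open>maj (Suc n) x\<close> adds
  \<open>lip n\<close> once more, as radii are 1-Lipschitz, and the new radius term adds
  \<open>y (Suc (Suc n))\<close>: this is the recursion of \<open>lip\<close>.\<close>

lemma maj_lipschitz:
  "maj n x + y (Suc n) * r n x \<le> maj n u + y (Suc n) * r n u + lip n * dist x u"
proof (induction n)
  case 0
  then show ?case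
    using mult_left_mono[OF r_lipschitz[of 0 x u], of "y 1"] y_pos[of 1] by (simp add: algebra_simps)
next
  case (Suc n)
  have "lip n * r (Suc n) x \<le> lip n * (r (Suc n) u + dist x u)"
    using r_lipschitz lip_pos by (intro mult_left_mono) (auto simp: less_imp_le)
  moreover have "y (Suc (Suc n)) * r (Suc n) x \<le> y (Suc (Suc n)) * (r (Suc n) u + dist x u)"
    using r_lipschitz y_pos by (intro mult_left_mono) (auto simp: less_imp_le)
  ultimately show ?case using Suc by (simp add: algebra_simps)
qed

lemma nn_integral_kernel_le:
  assumes "\<And>u. dist x u \<le> r k x \<Longrightarrow> g u \<le> c"
  shows "(\<integral>\<^sup>+u. \<kappa> k x u * g u \<partial>m) \<le> c"
proof -
  have "(\<integral>\<^sup>+u. \<kappa> k x u * g u \<partial>m) \<le> (\<integral>\<^sup>+u. \<kappa> k x u * c \<partial>m)"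
    using kernel_support assms by (intro nn_integral_mono) (metis mult_left_mono mult_zero_left zero_le order_refl)
  also have "\<dots> = c" by (subst nn_integral_multc) (auto simp: kernel_mass)
  finally show ?thesis .
qed

text \<open>Triangle inequality through an intermediate u, integrated over the far point and then
  averaged over u with a kernel of mass 1.\<close>

lemma osc_0_le:
  assumes [measurable]: "f \<in> borel_measurable borel"
  shows "osc f 0 x \<le> osc f k x + (\<integral>\<^sup>+u. \<kappa> k x u * osc f 0 u \<partial>m)"
proof -
  have "osc f 0 x \<le> ennreal \<bar>f x - f u\<bar> + osc f 0 u" for u
  proof -
    have "osc f 0 x \<le> (\<integral>\<^sup>+v. ennreal \<bar>f x - f u\<bar> + ennreal \<bar>f u - f v\<bar> \<partial>m)"
      unfolding osc_def kernel_0
      by (intro nn_integral_mono) (auto simp: ennreal_plus[symmetric] simp del: ennreal_plus intro!: ennreal_leI)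
    also have "\<dots> = ennreal \<bar>f x - f u\<bar> + osc f 0 u"
      unfolding osc_def kernel_0 by (subst nn_integral_add) (auto simp: emeasure_space_1)
    finally show ?thesis .
  qed
  then have "(\<integral>\<^sup>+u. \<kappa> k x u * osc f 0 x \<partial>m) \<le> (\<integral>\<^sup>+u. \<kappa> k x u * (ennreal \<bar>f x - f u\<bar> + osc f 0 u) \<partial>m)"
    by (intro nn_integral_mono mult_left_mono) auto
  also have "\<dots> = osc f k x + (\<integral>\<^sup>+u. \<kappa> k x u * osc f 0 u \<partial>m)"
    unfolding distrib_left osc_def by (subst nn_integral_add) auto
  finally show ?thesis by (subst (asm) nn_integral_multc) (auto simp: kernel_mass)
qed

text \<open>With q the quotient of increment and distance, the increment is at most
  \<open>q * r k x = y j * r k x * (q / y j)\<close>, and \<open>growth\<close> bounds the last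
  factor. The index j stays free; chaining takes \<open>Suc k\<close>.\<close>

lemma increment_le:
  assumes "dist x u \<le> r k x"
  shows "\<bar>f x - f u\<bar> \<le> a * (y j * r k x)
     + b * (y j / \<phi> (y j)) * (r k x * \<phi> (\<bar>f x - f u\<bar> / dist x u))"
proof (cases "x = u")
  case True
  then show ?thesis
    using a_nonneg b_nonneg y_pos[of j] \<phi>_y_pos[of j] r_nonneg[of k x] \<phi>_nonneg[of 0]
    by (auto intro!: add_nonneg_nonneg mult_nonneg_nonneg divide_nonneg_nonneg simp: less_imp_le)
next
  case False
  define q where "q = \<bar>f x - f u\<bar> / dist x u"
  have "\<bar>f x - f u\<bar> = q * dist x u" using False by (simp add: q_def)
  also have "\<dots> \<le> q * r k x" using assms by (intro mult_left_mono) (auto simp: q_def)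
  also have "\<dots> = y j * r k x * (q / y j)" using y_pos[of j] by simp
  also have "\<dots> \<le> y j * r k x * (a + b * (\<phi> q / \<phi> (y j)))"
    using y_pos[of j] r_nonneg[of k x] by (intro mult_left_mono growth) (auto simp: q_def less_imp_le)
  finally show ?thesis by (simp add: q_def algebra_simps)
qed

lemma osc_le:
  assumes [measurable]: "f \<in> borel_measurable borel"
  shows "osc f k x \<le> ennreal (a * (y j * r k x)) + ennreal (b * (y j / \<phi> (y j))) *
     (ennreal (r k x) * (\<integral>\<^sup>+u. \<kappa> k x u * ennreal (\<phi> (\<bar>f x - f u\<bar> / dist x u)) \<partial>m))"
proof -
  let ?c = "a * (y j * r k x)" and ?d = "b * (y j / \<phi> (y j))"
  have nn: "0 \<le> ?c" "0 \<le> ?d"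
    using a_nonneg b_nonneg y_pos[of j] \<phi>_y_pos[of j] r_nonneg[of k x] by auto
  have "osc f k x \<le> (\<integral>\<^sup>+u. \<kappa> k x u * (ennreal ?c + ennreal ?d * (ennreal (r k x) * ennreal (\<phi> (\<bar>f x - f u\<bar> / dist x u)))) \<partial>m)"
    unfolding osc_def
  proof (intro nn_integral_mono)
    fix u
    show "\<kappa> k x u * ennreal \<bar>f x - f u\<bar>
        \<le> \<kappa> k x u * (ennreal ?c + ennreal ?d * (ennreal (r k x) * ennreal (\<phi> (\<bar>f x - f u\<bar> / dist x u))))"
    proof (cases "\<kappa> k x u = 0")
      case False
      have "ennreal \<bar>f x - f u\<bar> \<le> ennreal (?c + ?d * (r k x * \<phi> (\<bar>f x - f u\<bar> / dist x u)))"
        by (intro ennreal_leI increment_le kernel_support False)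
      also have "\<dots> = ennreal ?c + ennreal ?d * (ennreal (r k x) * ennreal (\<phi> (\<bar>f x - f u\<bar> / dist x u)))"
        using nn r_nonneg[of k x] \<phi>_nonneg[of "\<bar>f x - f u\<bar> / dist x u"]
        by (subst ennreal_plus) (auto simp: ennreal_mult simp del: times_divide_eq_left times_divide_eq_right)
      finally show ?thesis by (intro mult_left_mono) auto
    qed simp
  qed
  also have "\<dots> = (\<integral>\<^sup>+u. \<kappa> k x u * ennreal ?c +
      ennreal ?d * (ennreal (r k x) * (\<kappa> k x u * ennreal (\<phi> (\<bar>f x - f u\<bar> / dist x u)))) \<partial>m)"
    by (intro nn_integral_cong) (simp add: distrib_left mult_ac)
  also have "\<dots> = ennreal ?c + ennreal ?d *
     (ennreal (r k x) * (\<integral>\<^sup>+u. \<kappa> k x u * ennreal (\<phi> (\<bar>f x - f u\<bar> / dist x u)) \<partial>m))"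
    by (subst nn_integral_add; (subst nn_integral_cmult)?; (subst nn_integral_cmult)?; (subst nn_integral_multc)?)
      (auto simp: kernel_mass)
  finally show ?thesis .
qed

lemma nn_integral_kernel_osc_le:
  assumes [measurable]: "f \<in> borel_measurable borel"
  shows "(\<integral>\<^sup>+u. \<kappa> (Suc k) x u * osc f k u \<partial>m)
    \<le> (\<integral>\<^sup>+u. \<kappa> (Suc k) x u * ennreal (a * (y (Suc k) * r k u)) \<partial>m) + ennreal (b * y (Suc k)) * energy f k"
proof -
  let ?y = "y (Suc k)"
  let ?E = "\<lambda>u. ennreal (r k u) * (\<integral>\<^sup>+v. \<kappa> k u v * ennreal (\<phi> (\<bar>f u - f v\<bar> / dist u v)) \<partial>m)"
  let ?d = "ennreal (b * (?y / \<phi> ?y))"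
  have "(\<integral>\<^sup>+u. \<kappa> (Suc k) x u * osc f k u \<partial>m)
     \<le> (\<integral>\<^sup>+u. \<kappa> (Suc k) x u * ennreal (a * (?y * r k u)) + ennreal (b * ?y) * ?E u \<partial>m)"
  proof (intro nn_integral_mono)
    fix u
    \<comment> \<open>The bound on the density cancels the denominator \<open>\<phi> ?y\<close>; the
      second part then no longer sees x and integrates to the energy.\<close>
    have "\<kappa> (Suc k) x u * ?d \<le> ennreal (\<phi> ?y) * ?d" by (intro mult_right_mono kernel_le) auto
    also have "\<dots> = ennreal (b * ?y)"
      using \<phi>_y_pos[of "Suc k"] b_nonneg y_pos[of "Suc k"] by (subst ennreal_mult[symmetric]) auto
    finally have *: "\<kappa> (Suc k) x u * ?d \<le> ennreal (b * ?y)" .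
    have "\<kappa> (Suc k) x u * osc f k u \<le> \<kappa> (Suc k) x u * (ennreal (a * (?y * r k u)) + ?d * ?E u)"
      by (intro mult_left_mono osc_le) auto
    also have "\<dots> = \<kappa> (Suc k) x u * ennreal (a * (?y * r k u)) + (\<kappa> (Suc k) x u * ?d) * ?E u"
      by (simp add: distrib_left mult.assoc)
    also have "\<dots> \<le> \<kappa> (Suc k) x u * ennreal (a * (?y * r k u)) + ennreal (b * ?y) * ?E u"
      by (intro add_left_mono mult_right_mono *) auto
    finally show "\<kappa> (Suc k) x u * osc f k u \<le> \<dots>" .
  qed
  also have "\<dots> = (\<integral>\<^sup>+u. \<kappa> (Suc k) x u * ennreal (a * (?y * r k u)) \<partial>m) + ennreal (b * ?y) * energy f k"
    unfolding energy_def by (subst nn_integral_add; (subst nn_integral_cmult)?) auto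
  finally show ?thesis .
qed

lemma osc_measurable[measurable]:
  assumes [measurable]: "f \<in> borel_measurable borel"
  shows "osc f k \<in> borel_measurable borel"
  unfolding osc_def[abs_def] by measurable

text \<open>Induction with x arbitrary: the bound for n is averaged over the ball of radius
  \<open>r (Suc n) x\<close>, and \<open>osc_0_le\<close> leads back to x. The averaged
  \<open>osc f n\<close> splits into a part absorbed by \<open>maj\<close> and one more
  energy.\<close>

lemma chaining:
  assumes [measurable]: "f \<in> borel_measurable borel"
  shows "osc f 0 x \<le> osc f n x + ennreal (a * maj n x) + (\<Sum>k<n. ennreal (b * y (Suc k)) * energy f k)"
proof (induction n arbitrary: x)
  case (Suc n)
  let ?Z = "\<Sum>k<n. ennreal (b * y (Suc k)) * energy f k"
  let ?H = "\<lambda>u. maj n u + y (Suc n) * r n u"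
  let ?S = "\<lambda>g. \<integral>\<^sup>+u. \<kappa> (Suc n) x u * g u \<partial>m"
  have "?S (osc f 0) \<le> ?S (\<lambda>u. osc f n u + ennreal (a * maj n u) + ?Z)"
    by (intro nn_integral_mono mult_left_mono Suc) auto
  also have "\<dots> = ?S (osc f n) + ?S (\<lambda>u. ennreal (a * maj n u)) + ?Z"
    unfolding distrib_left
    by (subst nn_integral_add; (subst nn_integral_add)?; (subst nn_integral_multc)?) (auto simp: kernel_mass)
  also have "\<dots> \<le> (?S (\<lambda>u. ennreal (a * (y (Suc n) * r n u))) + ennreal (b * y (Suc n)) * energy f n)
      + ?S (\<lambda>u. ennreal (a * maj n u)) + ?Z"
    by (intro add_right_mono nn_integral_kernel_osc_le) fact
  also have "\<dots> = (?S (\<lambda>u. ennreal (a * (y (Suc n) * r n u))) + ?S (\<lambda>u. ennreal (a * maj n u)))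
      + (\<Sum>k<Suc n. ennreal (b * y (Suc k)) * energy f k)"
    by (simp add: ac_simps)
  finally have *: "?S (osc f 0) \<le> \<dots>" .
  have "?S (\<lambda>u. ennreal (a * (y (Suc n) * r n u))) + ?S (\<lambda>u. ennreal (a * maj n u)) = ?S (\<lambda>u. ennreal (a * ?H u))"
  proof (subst nn_integral_add[symmetric])
    have "ennreal (a * ?H u) = ennreal (a * (y (Suc n) * r n u)) + ennreal (a * maj n u)" for u
      using a_nonneg y_pos[of "Suc n"] r_nonneg[of n u] maj_nonneg[of n u]
      by (subst ennreal_plus[symmetric]) (auto simp: less_imp_le algebra_simps)
    then show "(\<integral>\<^sup>+u. \<kappa> (Suc n) x u * ennreal (a * (y (Suc n) * r n u)) + \<kappa> (Suc n) x u * ennreal (a * maj n u) \<partial>m)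
        = ?S (\<lambda>u. ennreal (a * ?H u))"
      by (simp only: distrib_left)
  qed measurable
  \<comment> \<open>On the ball, \<open>?H\<close> exceeds its value at the centre by at most
    \<open>lip n * r (Suc n) x\<close>, exactly the term added in
    \<open>maj (Suc n) x\<close>.\<close>
  also have "\<dots> \<le> ennreal (a * maj (Suc n) x)"
  proof (intro nn_integral_kernel_le ennreal_leI mult_left_mono a_nonneg)
    fix u assume "dist x u \<le> r (Suc n) x"
    then have "lip n * dist x u \<le> lip n * r (Suc n) x"
      using lip_pos[of n] by (intro mult_left_mono) auto
    then show "?H u \<le> maj (Suc n) x" using maj_lipschitz[of n u x] by (simp add: dist_commute)
  qed
  finally have "?S (osc f 0) \<le> ennreal (a * maj (Suc n) x) + (\<Sum>k<Suc n. ennreal (b * y (Suc k)) * energy f k)"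
    by (rule order_trans[OF * add_right_mono])
  then have "osc f 0 x \<le> osc f (Suc n) x + (ennreal (a * maj (Suc n) x) + (\<Sum>k<Suc n. ennreal (b * y (Suc k)) * energy f k))"
    by (rule order_trans[OF osc_0_le[OF assms] add_left_mono])
  then show ?case by (simp only: add.assoc)
qed simp

lemma maj_le:
  assumes R: "2 < R" and y_Suc: "\<And>k. y (Suc k) = R * y k"
  shows "maj n x \<le> (R - 1) / (R - 2) * (\<Sum>i\<le>n. y (Suc i) * r i x)"
proof -
  \<comment> \<open>The guess is stable under the recursion because
    \<open>2 / (R - 2) + 1 = R / (R - 2)\<close>.\<close>
  have lip_le: "lip k \<le> y (Suc (Suc k)) / (R - 2)" for k
  proof (induction k)
    case 0
    have "y 1 * (R - 2) \<le> y 1 * R" using y_pos[of 1] by (intro mult_left_mono) auto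
    then show ?case using R y_Suc[of 1] by (simp add: field_simps)
  next
    case (Suc k)
    have "lip (Suc k) \<le> 2 * (y (Suc (Suc k)) / (R - 2)) + y (Suc (Suc k))" using Suc by simp
    also have "\<dots> = y (Suc (Suc (Suc k))) / (R - 2)"
      using R y_Suc[of "Suc (Suc k)"] by (simp add: field_simps)
    finally show ?case .
  qed
  \<comment> \<open>The added term makes the induction close: level i contributes
    \<open>y (Suc i) * r i x\<close> once by itself and, for i > 0, at most
    \<open>1 / (R - 2)\<close> times more through \<open>lip\<close>.\<close>
  have "maj n x + y (Suc n) * r n x \<le> (R - 1) / (R - 2) * (\<Sum>i\<le>n. y (Suc i) * r i x)"
  proof (induction n)
    case 0
    have "1 * (y 1 * r 0 x) \<le> (R - 1) / (R - 2) * (y 1 * r 0 x)"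
      using R y_pos[of 1] r_nonneg[of 0 x] by (intro mult_right_mono) (auto simp: field_simps)
    then show ?case by simp
  next
    case (Suc n)
    let ?t = "y (Suc (Suc n)) * r (Suc n) x"
    have "lip n * r (Suc n) x \<le> y (Suc (Suc n)) / (R - 2) * r (Suc n) x"
      using lip_le r_nonneg by (intro mult_right_mono) auto
    then have "lip n * r (Suc n) x + ?t \<le> (1 / (R - 2) + 1) * ?t" by (simp add: algebra_simps)
    also have "1 / (R - 2) + 1 = (R - 1) / (R - 2)" using R by (simp add: field_simps)
    finally show ?case using Suc by (simp add: distrib_left)
  qed
  then show ?thesis using y_pos[of "Suc n"] r_nonneg[of n x] by (smt (verit) mult_nonneg_nonneg)
qed

text \<open>Both points are compared with a common u distributed by m; the factor 2 of the final
  bound arises here.\<close>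

lemma increment_le_osc_0:
  assumes [measurable]: "f \<in> borel_measurable borel"
  shows "ennreal \<bar>f s - f t\<bar> \<le> osc f 0 s + osc f 0 t"
proof -
  have "ennreal \<bar>f s - f t\<bar> = (\<integral>\<^sup>+u. ennreal \<bar>f s - f t\<bar> \<partial>m)"
    by (simp add: emeasure_space_1)
  also have "\<dots> \<le> (\<integral>\<^sup>+u. ennreal \<bar>f s - f u\<bar> + ennreal \<bar>f t - f u\<bar> \<partial>m)"
    by (intro nn_integral_mono)
      (auto simp: ennreal_plus[symmetric] simp del: ennreal_plus intro!: ennreal_leI)
  also have "\<dots> = osc f 0 s + osc f 0 t"
    unfolding osc_def kernel_0 by (subst nn_integral_add) auto
  finally show ?thesis .
qed

section \<open>Expectations along a jointly measurable process\<close>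

context
  fixes P :: "'w measure" and Y :: "'t \<Rightarrow> 'w \<Rightarrow> real"
  assumes P: "prob_space P"
    and Y: "(\<lambda>p. Y (fst p) (snd p)) \<in> borel_measurable (borel \<Otimes>\<^sub>M P)"
begin

interpretation P: prob_space P by (rule P)
interpretation mP: pair_sigma_finite m P ..

lemma process_measurable[measurable]:
  assumes [measurable]: "g \<in> N \<rightarrow>\<^sub>M borel" "h \<in> N \<rightarrow>\<^sub>M P"
  shows "(\<lambda>z. Y (g z) (h z)) \<in> borel_measurable N"
  using measurable_compose[OF _ Y, of "\<lambda>z. (g z, h z)" N] by simp

lemma process_osc_measurable[measurable]: "(\<lambda>\<omega>. osc (\<lambda>t. Y t \<omega>) k x) \<in> borel_measurable P"
  unfolding osc_def by measurable

lemma process_energy_measurable[measurable]: "(\<lambda>\<omega>. energy (\<lambda>t. Y t \<omega>) k) \<in> borel_measurable P"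
  unfolding energy_def by measurable

text \<open>Tonelli, then the kernel mean of \<open>C * dist x u\<close> over the ball. This
  remainder vanishes as the radii shrink.\<close>

lemma expected_osc_le:
  assumes "0 \<le> C" and "\<And>s t. (\<integral>\<^sup>+\<omega>. ennreal \<bar>Y s \<omega> - Y t \<omega>\<bar> \<partial>P) \<le> ennreal (C * dist s t)"
  shows "(\<integral>\<^sup>+\<omega>. osc (\<lambda>t. Y t \<omega>) k x \<partial>P) \<le> ennreal (C * r k x)"
proof -
  have "(\<integral>\<^sup>+\<omega>. osc (\<lambda>t. Y t \<omega>) k x \<partial>P)
      = (\<integral>\<^sup>+u. (\<integral>\<^sup>+\<omega>. \<kappa> k x u * ennreal \<bar>Y x \<omega> - Y u \<omega>\<bar> \<partial>P) \<partial>m)"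
    unfolding osc_def by (rule mP.Fubini') measurable
  also have "\<dots> = (\<integral>\<^sup>+u. \<kappa> k x u * (\<integral>\<^sup>+\<omega>. ennreal \<bar>Y x \<omega> - Y u \<omega>\<bar> \<partial>P) \<partial>m)"
    by (intro nn_integral_cong nn_integral_cmult) measurable
  also have "\<dots> \<le> ennreal (C * r k x)"
    using assms(1)
    by (intro nn_integral_kernel_le order_trans[OF assms(2)] ennreal_leI mult_left_mono)
  finally show ?thesis .
qed

text \<open>Tonelli twice, for x and for u; the Young term has expectation at most 1 and the kernel
  has mass 1.\<close>

lemma expected_energy_le:
  assumes "\<And>s t. (\<integral>\<^sup>+\<omega>. ennreal (\<phi> (\<bar>Y s \<omega> - Y t \<omega>\<bar> / dist s t)) \<partial>P) \<le> 1"
  shows "(\<integral>\<^sup>+\<omega>. energy (\<lambda>t. Y t \<omega>) k \<partial>P) \<le> (\<integral>\<^sup>+x. ennreal (r k x) \<partial>m)"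
proof -
  let ?g = "\<lambda>x u \<omega>. ennreal (\<phi> (\<bar>Y x \<omega> - Y u \<omega>\<bar> / dist x u))"
  have "(\<integral>\<^sup>+\<omega>. energy (\<lambda>t. Y t \<omega>) k \<partial>P)
      = (\<integral>\<^sup>+x. (\<integral>\<^sup>+\<omega>. ennreal (r k x) * (\<integral>\<^sup>+u. \<kappa> k x u * ?g x u \<omega> \<partial>m) \<partial>P) \<partial>m)"
    unfolding energy_def by (rule mP.Fubini') measurable
  also have "\<dots> = (\<integral>\<^sup>+x. ennreal (r k x) * (\<integral>\<^sup>+\<omega>. (\<integral>\<^sup>+u. \<kappa> k x u * ?g x u \<omega> \<partial>m) \<partial>P) \<partial>m)"
    by (intro nn_integral_cong nn_integral_cmult) measurable
  also have "\<dots> \<le> (\<integral>\<^sup>+x. ennreal (r k x) * 1 \<partial>m)"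
  proof (intro nn_integral_mono mult_left_mono)
    fix x
    have "(\<integral>\<^sup>+\<omega>. (\<integral>\<^sup>+u. \<kappa> k x u * ?g x u \<omega> \<partial>m) \<partial>P) = (\<integral>\<^sup>+u. (\<integral>\<^sup>+\<omega>. \<kappa> k x u * ?g x u \<omega> \<partial>P) \<partial>m)"
      by (rule mP.Fubini') measurable
    also have "\<dots> = (\<integral>\<^sup>+u. \<kappa> k x u * (\<integral>\<^sup>+\<omega>. ?g x u \<omega> \<partial>P) \<partial>m)"
      by (intro nn_integral_cong nn_integral_cmult) measurable
    also have "\<dots> \<le> 1" by (intro nn_integral_kernel_le assms)
    finally show "(\<integral>\<^sup>+\<omega>. (\<integral>\<^sup>+u. \<kappa> k x u * ?g x u \<omega> \<partial>m) \<partial>P) \<le> 1" .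
  qed simp
  finally show ?thesis by simp
qed

lemma expected_sup_finite_le:
  assumes "finite F" and "0 \<le> C"
    and lip: "\<And>s t. (\<integral>\<^sup>+\<omega>. ennreal \<bar>Y s \<omega> - Y t \<omega>\<bar> \<partial>P) \<le> ennreal (C * dist s t)"
    and young: "\<And>s t. (\<integral>\<^sup>+\<omega>. ennreal (\<phi> (\<bar>Y s \<omega> - Y t \<omega>\<bar> / dist s t)) \<partial>P) \<le> 1"
    and M: "\<And>x. ennreal (a * maj n x) \<le> M"
  shows "(\<integral>\<^sup>+\<omega>. (SUP s\<in>F. SUP t\<in>F. ennreal \<bar>Y s \<omega> - Y t \<omega>\<bar>) \<partial>P)
    \<le> 2 * (M + (\<Sum>k<n. ennreal (b * y (Suc k)) * (\<integral>\<^sup>+x. ennreal (r k x) \<partial>m)) + (\<Sum>s\<in>F. ennreal (C * r n s)))"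
proof -
  let ?f = "\<lambda>\<omega> t. Y t \<omega>"
  let ?Z = "\<lambda>\<omega>. \<Sum>k<n. ennreal (b * y (Suc k)) * energy (?f \<omega>) k"
  have "(\<integral>\<^sup>+\<omega>. (SUP s\<in>F. SUP t\<in>F. ennreal \<bar>Y s \<omega> - Y t \<omega>\<bar>) \<partial>P)
     \<le> (\<integral>\<^sup>+\<omega>. 2 * (M + ?Z \<omega> + (\<Sum>s\<in>F. osc (?f \<omega>) n s)) \<partial>P)"
  proof (intro nn_integral_mono SUP_least)
    fix \<omega> s t assume \<omega>: "\<omega> \<in> space P" and st: "s \<in> F" "t \<in> F"
    have [measurable]: "?f \<omega> \<in> borel_measurable borel" using \<omega> by measurable
    \<comment> \<open>The bound must not depend on s: M is uniform, and the remainder at s is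
      enlarged to the sum over the finite set F.\<close>
    have *: "osc (?f \<omega>) 0 s \<le> M + ?Z \<omega> + (\<Sum>s\<in>F. osc (?f \<omega>) n s)" if "s \<in> F" for s
    proof -
      have "osc (?f \<omega>) 0 s \<le> osc (?f \<omega>) n s + ennreal (a * maj n s) + ?Z \<omega>" by (rule chaining) measurable
      also have "\<dots> \<le> (\<Sum>s\<in>F. osc (?f \<omega>) n s) + M + ?Z \<omega>"
        using that \<open>finite F\<close> by (intro add_mono M order_refl member_le_sum) auto
      finally show ?thesis by (simp add: ac_simps)
    qed
    have "ennreal \<bar>Y s \<omega> - Y t \<omega>\<bar> \<le> osc (?f \<omega>) 0 s + osc (?f \<omega>) 0 t"
      by (rule increment_le_osc_0) measurable
    also have "\<dots> \<le> 2 * (M + ?Z \<omega> + (\<Sum>s\<in>F. osc (?f \<omega>) n s))"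
      unfolding mult_2 by (intro add_mono * st)
    finally show "ennreal \<bar>Y s \<omega> - Y t \<omega>\<bar> \<le> \<dots>" .
  qed
  also have "\<dots> = 2 * (M + (\<integral>\<^sup>+\<omega>. ?Z \<omega> \<partial>P) + (\<integral>\<^sup>+\<omega>. (\<Sum>s\<in>F. osc (?f \<omega>) n s) \<partial>P))"
    by (simp add: nn_integral_cmult nn_integral_add P.emeasure_space_1)
  also have "(\<integral>\<^sup>+\<omega>. ?Z \<omega> \<partial>P) = (\<Sum>k<n. ennreal (b * y (Suc k)) * (\<integral>\<^sup>+\<omega>. energy (?f \<omega>) k \<partial>P))"
    by (simp add: nn_integral_cmult nn_integral_sum)
  also have "(\<integral>\<^sup>+\<omega>. (\<Sum>s\<in>F. osc (?f \<omega>) n s) \<partial>P) = (\<Sum>s\<in>F. \<integral>\<^sup>+\<omega>. osc (?f \<omega>) n s \<partial>P)"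
    by (simp add: nn_integral_sum)
  finally show ?thesis
    by (rule order_trans)
      (intro mult_left_mono add_mono sum_mono order_refl expected_energy_le[OF young]
        expected_osc_le[OF \<open>0 \<le> C\<close> lip] zero_le)
qed

end
end

text \<open>Only the topmost active layer i counts: the weights
  \<open>(1 - 1 / R) * (c * R ^ i)\<close> are differences of consecutive powers, so the layers up
  to i add up to at most \<open>c * R ^ i \<le> v\<close>. The induction on n searches for that
  layer.\<close>

lemma geometric_layers_le:
  fixes R c v e :: real
  assumes "1 < R" "0 \<le> c" "0 \<le> v" and le: "\<And>i. i \<le> n \<Longrightarrow> e < r i \<Longrightarrow> c * R ^ i \<le> v"
  shows "(\<Sum>i\<le>n. (1 - 1 / R) * (c * R ^ i) * of_bool (e < r i)) \<le> v"
  using le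
proof (induction n)
  case 0
  have "(1 - 1 / R) * c \<le> 1 * c" using assms by (intro mult_right_mono) auto
  then show ?case using 0[of 0] \<open>0 \<le> v\<close> by (auto simp: of_bool_def)
next
  case (Suc n)
  show ?case
  proof (cases "e < r (Suc n)")
    case True
    have "(\<Sum>i\<le>k. (1 - 1 / R) * (c * R ^ i) * of_bool (e < r i)) \<le> c * R ^ k" for k
    proof (induction k)
      case 0
      have "(1 - 1 / R) * c \<le> 1 * c" using assms by (intro mult_right_mono) auto
      then show ?case using \<open>0 \<le> c\<close> by (auto simp: of_bool_def)
    next
      case (Suc k)
      have "(1 - 1 / R) * (c * R ^ Suc k) * of_bool (e < r (Suc k)) \<le> (1 - 1 / R) * (c * R ^ Suc k)"
        using assms by (auto simp: of_bool_def)
      also have "\<dots> = c * R ^ Suc k - c * R ^ k" using \<open>1 < R\<close> by (simp add: field_simps)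
      finally show ?case using Suc by simp
    qed
    then show ?thesis using Suc.prems[of "Suc n"] True by (meson order_refl order_trans)
  qed (use Suc in auto)
qed

section \<open>Majorizing measures\<close>

locale growth_function =
  fixes \<phi> :: "real \<Rightarrow> real" and a b :: real
  assumes G: "\<phi> \<in> G_class a b"
begin

abbreviation \<psi> where "\<psi> \<equiv> inv_pos \<phi>"

lemma \<phi>_less: "0 \<le> s \<Longrightarrow> s < t \<Longrightarrow> \<phi> s < \<phi> t"
  using G by (auto simp: G_class_def strict_mono_on_def)

lemma \<phi>_0: "\<phi> 0 = 0" using G by (simp add: G_class_def)

lemma \<phi>_continuous: "continuous_on {0..} \<phi>" using G by (simp add: G_class_def)

lemma \<phi>_mono: "0 \<le> s \<Longrightarrow> s \<le> t \<Longrightarrow> \<phi> s \<le> \<phi> t"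
  using \<phi>_less[of s t] by (cases "s = t") auto

lemma \<phi>_nonneg: "0 \<le> t \<Longrightarrow> 0 \<le> \<phi> t" using \<phi>_mono[of 0 t] \<phi>_0 by simp

lemma \<psi>_nonneg: "0 \<le> z \<Longrightarrow> 0 \<le> \<psi> z"
  using G inv_into_into[of z \<phi> "{0..}"] by (auto simp: G_class_def)

lemma \<phi>_\<psi>: "0 \<le> z \<Longrightarrow> \<phi> (\<psi> z) = z"
  using G f_inv_into_f[of z \<phi> "{0..}"] by (auto simp: G_class_def)

lemma le_\<psi>: "0 \<le> t \<Longrightarrow> \<phi> t \<le> z \<Longrightarrow> t \<le> \<psi> z"
  using \<phi>_less[of "\<psi> z" t] \<phi>_\<psi>[of z] \<psi>_nonneg[of z] \<phi>_nonneg[of t] by force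

lemma \<psi>_mono: "0 \<le> z \<Longrightarrow> z \<le> w \<Longrightarrow> \<psi> z \<le> \<psi> w"
  using le_\<psi>[of "\<psi> z" w] \<phi>_\<psi>[of z] \<psi>_nonneg[of z] by simp

lemma \<psi>_1_pos: "0 < \<psi> 1"
  using \<phi>_\<psi>[of 1] \<psi>_nonneg[of 1] \<phi>_0 by (cases "\<psi> 1 = 0") auto

lemma growth_quotient:
  assumes "\<psi> 1 \<le> t" "0 \<le> q"
  shows "q / t \<le> a + b * (\<phi> q / \<phi> t)"
proof -
  have t: "0 < t" using assms \<psi>_1_pos by linarith
  have "\<forall>x\<ge>0. \<forall>y\<ge>\<psi> 1. x \<le> a + b * (\<phi> (x * y) / \<phi> y)"
    using G unfolding G_class_def by blast
  then have "q / t \<le> a + b * (\<phi> (q / t * t) / \<phi> t)"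
    using t assms by (metis divide_nonneg_pos)
  then show ?thesis using t by simp
qed

text \<open>Otherwise every \<open>x \<ge> 0\<close> would be at most a. With b positive, an
  infinite mean makes the final bound infinite.\<close>

lemma b_nonzero: "b \<noteq> 0"
proof
  assume "b = 0"
  then have "x \<le> a" if "0 \<le> x" for x using G that unfolding G_class_def by auto
  from this[of "\<bar>a\<bar> + 1"] show False by auto
qed

end

lemma measure_cball_pos_if_support:
  fixes m :: "'t::metric_space measure"
  assumes "finite_measure m" "sets m = sets borel" "msupport m = UNIV" "0 < e"
  shows "0 < measure m (cball x e)"
proof -
  interpret finite_measure m by fact
  have "x \<in> msupport m" using assms by simp
  then have "0 < emeasure m (ball x e)" using \<open>0 < e\<close> by (simp add: msupport_def)
  also have "\<dots> \<le> emeasure m (cball x e)" using assms by (intro emeasure_mono) auto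
  finally show ?thesis by (simp add: emeasure_eq_measure)
qed

text \<open>The case of finite positive diameter D; q is the dense sequence that separability of the
  process supplies.\<close>

locale majorizing_measure = growth_function \<phi> a b + prob_space m
  for \<phi> a b and m :: "'t::metric_space measure" +
  fixes R D :: real and q :: "nat \<Rightarrow> 't"
  assumes a_nonneg: "0 \<le> a" and b_nonneg: "0 \<le> b"
    and sets_m: "sets m = sets borel"
    and support: "msupport m = UNIV"
    and R: "2 \<le> R"
    and D_pos: "0 < D" and ediam: "ediam (UNIV :: 't set) = ennreal D"
    and dense: "\<And>t \<epsilon>. 0 < \<epsilon> \<Longrightarrow> \<exists>i. dist t (q i) < \<epsilon>"
begin

lemma cball_sets[measurable, simp]: "cball x e \<in> sets m" by (simp add: sets_m)

lemmas measure_cball_pos = measure_cball_pos_if_support[OF finite_measure_axioms sets_m support]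

lemma dist_le_D: "dist x z \<le> D" for x z :: 't
proof -
  have "ennreal (dist x z) \<le> ediam (UNIV :: 't set)"
    unfolding ediam_def by (auto intro: SUP_upper2)
  then show ?thesis using D_pos by (simp add: ediam)
qed

lemma measure_cball_D: "measure m (cball x D) = 1"
proof -
  have "cball x D = space m" using dist_le_D sets_eq_imp_space_eq[OF sets_m] by auto
  then show ?thesis by (simp add: prob_space)
qed

text \<open>
  Starting the scale exactly at \<open>\<psi> 1\<close> allows \<open>r 0 = D\<close>: the first average is the global mean, yet
  \<open>y 0\<close> still bounds the integrand of \<open>mm_sigma\<close> from below on all of \<open>(0, D)\<close>.
\<close>

definition y :: "nat \<Rightarrow> real" where "y k = \<psi> 1 * R ^ k"

definition r :: "nat \<Rightarrow> 't \<Rightarrow> real" where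
  "r k x = (if k = 0 then D else mass_radius m (1 / \<phi> (y k)) x)"

definition \<kappa> :: "nat \<Rightarrow> 't \<Rightarrow> 't \<Rightarrow> ennreal" where
  "\<kappa> k x u = (if dist x u \<le> r k x then ennreal (1 / measure m (cball x (r k x))) else 0)"

lemma y_ge: "\<psi> 1 \<le> y k"
  unfolding y_def using R \<psi>_1_pos by simp

lemma \<phi>_y_ge_1: "1 \<le> \<phi> (y k)"
  using \<phi>_mono[OF _ y_ge, of k] \<phi>_\<psi>[of 1] \<psi>_1_pos by simp

lemma mass_le_measure_cball_D: "1 / \<phi> (y k) \<le> measure m (cball x D)"
  using \<phi>_y_ge_1[of k] by (simp add: measure_cball_D)

text \<open>The ball of radius D is the whole space, so D is a radius of sufficient mass.\<close>

lemmas radius_exists = less_imp_le[OF D_pos] mass_le_measure_cball_D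

lemma r_nonneg: "0 \<le> r k x"
  using D_pos mass_radius_nonneg[OF radius_exists] by (simp add: r_def)

lemma r_le_D: "r k x \<le> D"
  using mass_radius_le[OF radius_exists] by (simp add: r_def)

lemma r_lipschitz: "r k x \<le> r k u + dist x u"
  using mass_radius_lipschitz[OF finite_measure_axioms sets_m radius_exists] by (simp add: r_def)

lemma measure_cball_r: "1 / \<phi> (y k) \<le> measure m (cball x (r k x))"
  using mass_le_measure_cball_D measure_cball_mass_radius[OF finite_measure_axioms sets_m radius_exists]
  by (simp add: r_def)

lemma measure_cball_r_pos: "0 < measure m (cball x (r k x))"
  using measure_cball_r[of k x] \<phi>_y_ge_1[of k] by (smt (verit) zero_less_divide_1_iff)

text \<open>Full support gives the ball of radius \<open>e/2\<close> a mass \<delta> > 0, and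
  \<open>1 / \<phi> (y k)\<close> drops below \<delta> as \<open>y k\<close> grows
  geometrically.\<close>

lemma r_tendsto_0: "(\<lambda>k. r k x) \<longlonglongrightarrow> 0"
proof (rule LIMSEQ_I)
  fix e :: real assume "0 < e"
  define \<delta> where "\<delta> = measure m (cball x (e/2))"
  have \<delta>: "0 < \<delta>" unfolding \<delta>_def using \<open>0 < e\<close> by (intro measure_cball_pos) simp
  obtain N where "\<psi> (1 / \<delta>) / \<psi> 1 < R ^ N" using real_arch_pow[of R] R by auto
  then have "\<psi> (1 / \<delta>) \<le> y N" using \<psi>_1_pos by (simp add: y_def field_simps)
  moreover have "y N \<le> y k" if "N \<le> k" for k
    unfolding y_def using R \<psi>_1_pos that by (intro mult_left_mono power_increasing) auto
  ultimately have N: "\<psi> (1 / \<delta>) \<le> y k" if "N \<le> k" for k using that order_trans by blast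
  \<comment> \<open>Starting from \<open>Suc N\<close> excludes k = 0, where the radius is set to
    D.\<close>
  have "norm (r k x - 0) < e" if "Suc N \<le> k" for k
  proof -
    have "1 / \<delta> \<le> \<phi> (y k)"
      using \<phi>_mono[OF \<psi>_nonneg N[of k]] that \<delta> \<phi>_\<psi>[of "1/\<delta>"] by simp
    then have "1 / \<phi> (y k) \<le> \<delta>" using \<delta> \<phi>_y_ge_1[of k] by (simp add: field_simps)
    then have "r k x \<le> e / 2"
      using that \<open>0 < e\<close> mass_radius_le[of "e / 2" "1 / \<phi> (y k)" m x] by (simp add: r_def \<delta>_def)
    then show ?thesis using r_nonneg[of k x] \<open>0 < e\<close> by simp
  qed
  then show "\<exists>N. \<forall>k\<ge>N. norm (r k x - 0) < e" by blast
qed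

text \<open>Inside the radius the mass stays below \<open>1 / \<phi> (y k)\<close>, which the
  increasing inverse turns into the bound. For k = 0 mass at most 1 suffices, as
  \<open>y 0 = \<psi> 1\<close>.\<close>

lemma y_le_\<psi>:
  assumes "0 < e" "e < r k x"
  shows "y k \<le> \<psi> (1 / measure m (cball x e))"
proof (cases "k = 0")
  case True
  have "1 \<le> 1 / measure m (cball x e)" using measure_cball_pos[OF assms(1), of x] by simp
  then show ?thesis using True \<psi>_mono[of 1] by (simp add: y_def)
next
  case False
  then have "measure m (cball x e) < 1 / \<phi> (y k)"
    using assms mass_radius_less[of e m] by (simp add: r_def)
  then have "\<phi> (y k) \<le> 1 / measure m (cball x e)"
    using measure_cball_pos[OF assms(1), of x] \<phi>_y_ge_1[of k] by (simp add: field_simps)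
  then show ?thesis using y_ge[of k] \<psi>_1_pos by (intro le_\<psi>) auto
qed

text \<open>Since \<open>r i x\<close> is the length of \<open>{0<..<r i x}\<close>, the sum is the
  integral of a step function of e, which \<open>geometric_layers_le\<close> and
  \<open>y_le_\<psi>\<close> bound by the integrand of \<open>mm_sigma\<close>.\<close>

lemma mm_sigma_ge: "ennreal (\<Sum>i\<le>n. (1 - 1 / R) * y i * r i x) \<le> mm_sigma \<phi> m x"
proof -
  have c: "0 \<le> (1 - 1 / R) * y i" for i using R y_ge[of i] \<psi>_1_pos by simp
  have "ennreal (\<Sum>i\<le>n. (1 - 1 / R) * y i * r i x)
      = (\<Sum>i\<le>n. ennreal ((1 - 1 / R) * y i) * emeasure lborel {0<..<r i x})"
    using c r_nonneg by (subst sum_ennreal[symmetric]) (auto simp: ennreal_mult)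
  also have "\<dots> = (\<integral>\<^sup>+e. (\<Sum>i\<le>n. ennreal ((1 - 1 / R) * y i) * indicator {0<..<r i x} e) \<partial>lborel)"
    by (subst nn_integral_sum) (auto intro!: sum.cong simp: nn_integral_cmult_indicator)
  also have "\<dots> \<le> mm_sigma \<phi> m x"
    unfolding mm_sigma_def
  proof (intro nn_integral_mono)
    fix e :: real
    let ?v = "\<psi> (1 / measure m (cball x e))"
    show "(\<Sum>i\<le>n. ennreal ((1 - 1 / R) * y i) * indicator {0<..<r i x} e)
        \<le> ennreal ?v * indicator {e. 0 < e \<and> ennreal e < ediam (UNIV :: 't set)} e"
    proof (cases "0 < e \<and> e < D")
      case True
      have "(\<Sum>i\<le>n. ennreal ((1 - 1 / R) * y i) * indicator {0<..<r i x} e)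
          = (\<Sum>i\<le>n. ennreal ((1 - 1 / R) * (\<psi> 1 * R ^ i) * of_bool (e < r i x)))"
        using True by (intro sum.cong) (auto simp: y_def indicator_def)
      also have "\<dots> = ennreal (\<Sum>i\<le>n. (1 - 1 / R) * (\<psi> 1 * R ^ i) * of_bool (e < r i x))"
        using c unfolding y_def by (intro sum_ennreal) auto
      also have "\<dots> \<le> ennreal ?v"
        using R \<psi>_1_pos True y_le_\<psi>[unfolded y_def]
        by (intro ennreal_leI geometric_layers_le \<psi>_nonneg) auto
      finally show ?thesis using True D_pos by (simp add: ediam ennreal_less_iff)
    next
      case False
      then have "indicator {0<..<r i x} e = (0::ennreal)" for i
        using r_le_D[of i x] by (auto simp: indicator_def)
      then show ?thesis by simp
    qed
  qed
  finally show ?thesis .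
qed

text \<open>B arises from \<open>y (Suc i) = R * y i\<close> and
  \<open>R = R^2 / (R - 1) * (1 - 1 / R)\<close>.\<close>

lemma sum_y_r_le:
  "ennreal (\<Sum>i\<le>n. y (Suc i) * r i x) \<le> const_B R * mm_sigma \<phi> m x"
proof -
  have "(\<Sum>i\<le>n. y (Suc i) * r i x) = R\<^sup>2 / (R - 1) * (\<Sum>i\<le>n. (1 - 1 / R) * y i * r i x)"
    unfolding sum_distrib_left using R
    by (intro sum.cong) (auto simp: y_def field_simps power2_eq_square)
  then have "ennreal (\<Sum>i\<le>n. y (Suc i) * r i x)
      = const_B R * ennreal (\<Sum>i\<le>n. (1 - 1 / R) * y i * r i x)"
    using R by (simp only: const_B_def) (rule ennreal_mult'; simp)
  then show ?thesis by (simp add: mult_left_mono mm_sigma_ge)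
qed

sublocale averaging_kernels m \<kappa> r \<phi> y a b
proof
  show sets: "sets m = sets borel" by (rule sets_m)
  show dist: "(\<lambda>p::'t \<times> 't. dist (fst p) (snd p)) \<in> borel_measurable (borel \<Otimes>\<^sub>M borel)"
    by (rule measurable_dist_pair[OF dense])
  show "0 \<le> r k x" for k x by (rule r_nonneg)
  show "r k x \<le> r k u + dist x u" for k x u by (rule r_lipschitz)
  have [measurable]: "r k \<in> borel_measurable borel" for k
    by (rule borel_measurable_lipschitz[OF r_lipschitz])
  note [measurable] = dist
  note [measurable_cong] = sets_m
  show "(\<lambda>p. \<kappa> k (fst p) (snd p)) \<in> borel_measurable (borel \<Otimes>\<^sub>M borel)" for k
  proof -
    \<comment> \<open>As an integral over one variable of a jointly measurable function, the mass of
      the ball is measurable in its centre.\<close>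
    have "emeasure m (cball x (r k x)) = (\<integral>\<^sup>+u. (if dist x u \<le> r k x then 1 else 0) \<partial>m)" for x
    proof -
      have "(\<integral>\<^sup>+u. (if dist x u \<le> r k x then 1 else 0) \<partial>m) = (\<integral>\<^sup>+u. indicator (cball x (r k x)) u \<partial>m)"
        by (intro nn_integral_cong) (auto simp: indicator_def)
      then show ?thesis by simp
    qed
    moreover have "(\<lambda>x. \<integral>\<^sup>+u. (if dist (fst (x, u)) (snd (x, u)) \<le> r k x then 1 else 0) \<partial>m) \<in> borel_measurable borel"
      using measurable_compose[OF _ dist] by measurable
    ultimately have [measurable]: "(\<lambda>x. measure m (cball x (r k x))) \<in> borel_measurable borel"
      unfolding measure_def by simp
    show ?thesis unfolding \<kappa>_def by measurable
  qed
  show "(\<integral>\<^sup>+u. \<kappa> k x u \<partial>m) = 1" for k x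
  proof -
    have "(\<integral>\<^sup>+u. \<kappa> k x u \<partial>m)
        = (\<integral>\<^sup>+u. ennreal (1 / measure m (cball x (r k x))) * indicator (cball x (r k x)) u \<partial>m)"
      by (intro nn_integral_cong) (auto simp: \<kappa>_def indicator_def)
    also have "\<dots> = ennreal (1 / measure m (cball x (r k x)) * measure m (cball x (r k x)))"
      by (subst nn_integral_cmult_indicator)
        (simp_all add: emeasure_eq_measure ennreal_mult[symmetric])
    also have "\<dots> = 1" using measure_cball_r_pos[of x k] by simp
    finally show ?thesis .
  qed
  show "\<kappa> 0 x u = 1" for x u
    using dist_le_D measure_cball_D by (simp add: \<kappa>_def r_def)
  show "dist x u \<le> r k x" if "\<kappa> k x u \<noteq> 0" for k x u
    using that by (simp add: \<kappa>_def split: if_splits)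
  show "\<kappa> (Suc k) x u \<le> ennreal (\<phi> (y (Suc k)))" for k x u
  proof -
    have "1 / measure m (cball x (r (Suc k) x)) \<le> \<phi> (y (Suc k))"
      using measure_cball_r[of "Suc k" x] measure_cball_r_pos[of x "Suc k"] \<phi>_y_ge_1[of "Suc k"]
      by (simp add: field_simps)
    then show ?thesis by (simp add: \<kappa>_def ennreal_leI)
  qed
  show "continuous_on {0..} \<phi>" by (rule \<phi>_continuous)
  show "0 \<le> \<phi> q" if "0 \<le> q" for q using that by (rule \<phi>_nonneg)
  show "0 < y k" for k using y_ge[of k] \<psi>_1_pos by linarith
  show "0 < \<phi> (y k)" for k using \<phi>_y_ge_1[of k] by linarith
  show "0 \<le> a" "0 \<le> b" by (rule a_nonneg b_nonneg)+
  show "q / y k \<le> a + b * (\<phi> q / \<phi> (y k))" if "0 \<le> q" for k q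
    by (rule growth_quotient[OF y_ge that])
qed

lemma sum_integral_r_le:
  "(\<Sum>k<n. ennreal (y (Suc k)) * (\<integral>\<^sup>+x. ennreal (r k x) \<partial>m)) \<le> const_B R * mm_mean \<phi> m"
proof -
  have c: "0 \<le> (1 - 1 / R) * y i" for i using R y_ge[of i] \<psi>_1_pos by simp
  have "(\<Sum>k<n. ennreal (y (Suc k)) * (\<integral>\<^sup>+x. ennreal (r k x) \<partial>m))
     \<le> (\<Sum>k\<le>n. ennreal (y (Suc k)) * (\<integral>\<^sup>+x. ennreal (r k x) \<partial>m))"
    by (intro sum_mono2) auto
  also have "\<dots> = (\<Sum>k\<le>n. const_B R * (ennreal ((1 - 1 / R) * y k) * (\<integral>\<^sup>+x. ennreal (r k x) \<partial>m)))"
  proof (intro sum.cong refl)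
    fix k
    have "y (Suc k) = R\<^sup>2 / (R - 1) * ((1 - 1 / R) * y k)"
      using R by (simp add: y_def field_simps power2_eq_square)
    then have "ennreal (y (Suc k)) = const_B R * ennreal ((1 - 1 / R) * y k)"
      using R by (simp only: const_B_def) (rule ennreal_mult'; simp)
    then show "ennreal (y (Suc k)) * (\<integral>\<^sup>+x. ennreal (r k x) \<partial>m)
      = const_B R * (ennreal ((1 - 1 / R) * y k) * (\<integral>\<^sup>+x. ennreal (r k x) \<partial>m))"
      by (simp only: mult.assoc)
  qed
  also have "\<dots> = const_B R * (\<Sum>k\<le>n. \<integral>\<^sup>+x. ennreal ((1 - 1 / R) * y k) * ennreal (r k x) \<partial>m)"
    unfolding sum_distrib_left by (intro sum.cong refl arg_cong[where f="\<lambda>z. const_B R * z"] nn_integral_cmult[symmetric]) measurable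
  also have "\<dots> = const_B R * (\<integral>\<^sup>+x. (\<Sum>k\<le>n. ennreal ((1 - 1 / R) * y k) * ennreal (r k x)) \<partial>m)"
    by (subst nn_integral_sum) auto
  also have "\<dots> = const_B R * (\<integral>\<^sup>+x. ennreal (\<Sum>k\<le>n. (1 - 1 / R) * y k * r k x) \<partial>m)"
    using c r_nonneg
    by (intro arg_cong[where f="\<lambda>z. const_B R * z"] nn_integral_cong)
      (subst sum_ennreal[symmetric]; auto intro!: sum.cong simp: ennreal_mult)
  also have "\<dots> \<le> const_B R * mm_mean \<phi> m"
    unfolding mm_mean_def by (intro mult_left_mono nn_integral_mono mm_sigma_ge) auto
  finally show ?thesis .
qed

lemma maj_le_mm_sup: "ennreal (a * maj n x) \<le> ennreal a * const_A R * mm_sup \<phi> m"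
proof -
  have sup: "mm_sigma \<phi> m x \<le> mm_sup \<phi> m" unfolding mm_sup_def by (rule SUP_upper) simp
  show ?thesis
  proof (cases "R = 2")
    case True
    \<comment> \<open>A is infinite here, so \<open>mm_sup \<phi> m\<close> has to be nonzero lest
      \<open>0 * \<infinity>\<close> make the bound 0; the term \<open>y 1 * D\<close> shows this.
      For a = 0 both sides vanish.\<close>
    have "0 < ennreal (y 1 * r 0 x)" using y_pos[of 1] D_pos by (simp add: r_def)
    also have "\<dots> \<le> const_B R * mm_sigma \<phi> m x" using sum_y_r_le[where n = 0 and x = x] by simp
    finally have "mm_sup \<phi> m \<noteq> 0" using sup by auto
    then show ?thesis using True a_nonneg by (cases "a = 0") (auto simp: const_A_def ennreal_mult_eq_top_iff ennreal_top_mult ennreal_mult_top)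
  next
    case False
    then have R2: "2 < R" using R by simp
    have "a * maj n x \<le> a * ((R - 1) / (R - 2) * (\<Sum>i\<le>n. y (Suc i) * r i x))"
      using R2 a_nonneg by (intro mult_left_mono maj_le) (auto simp: y_def)
    then have "ennreal (a * maj n x) \<le> ennreal a * (ennreal ((R - 1) / (R - 2)) * ennreal (\<Sum>i\<le>n. y (Suc i) * r i x))"
      using R2 a_nonneg by (simp add: ennreal_mult'[symmetric] ennreal_leI)
    also have "\<dots> \<le> ennreal a * (ennreal ((R - 1) / (R - 2)) * (const_B R * mm_sup \<phi> m))"
      by (intro mult_left_mono order_trans[OF sum_y_r_le] sup zero_le)
    also have "\<dots> = ennreal a * ennreal ((R - 1) / (R - 2) * (R\<^sup>2 / (R - 1))) * mm_sup \<phi> m"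
      using R2 by (subst ennreal_mult) (auto simp: const_B_def mult.assoc)
    also have "\<dots> \<le> ennreal a * const_A R * mm_sup \<phi> m"
    proof (intro mult_right_mono mult_left_mono zero_le)
      \<comment> \<open>The product is \<open>R^2 / (R - 2)\<close>; A is larger by the factor
        \<open>R / (R - 1)\<close>.\<close>
      have "(R - 1) / (R - 2) * (R\<^sup>2 / (R - 1)) = R\<^sup>2 * (R - 1) / ((R - 1) * (R - 2))" using R2 by simp
      also have "\<dots> \<le> R ^ 3 / ((R - 1) * (R - 2))"
        using R2 by (intro divide_right_mono mult_nonneg_nonneg)
          (auto simp: power2_eq_square power3_eq_cube intro!: mult_left_mono)
      finally show "ennreal ((R - 1) / (R - 2) * (R\<^sup>2 / (R - 1))) \<le> const_A R"
        using R2 by (simp add: const_A_def ennreal_leI)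
    qed
    finally show ?thesis .
  qed
qed

lemma expected_sup_increment_le:
  fixes X :: "'t \<Rightarrow> 'w \<Rightarrow> real"
  assumes P: "prob_space P" and X[measurable]: "\<And>t. X t \<in> borel_measurable P"
    and young: "\<And>s t. (\<integral>\<^sup>+\<omega>. ennreal (\<phi> (\<bar>X s \<omega> - X t \<omega>\<bar> / dist s t)) \<partial>P) \<le> 1"
  shows "expected_sup_increment P X
    \<le> 2 * ennreal a * const_A R * mm_sup \<phi> m + 2 * ennreal b * const_B R * mm_mean \<phi> m"
proof -
  interpret P: prob_space P by (rule P)
  \<comment> \<open>From \<open>growth_quotient\<close> at \<open>t = \<psi> 1\<close>, where \<phi>
    equals 1: in expectation an increment is at most
    \<open>dist s t * \<psi> 1 * (a + b)\<close>.\<close>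
  define C where "C = \<psi> 1 * (a + b)"
  have C: "0 \<le> C" using \<psi>_1_pos a_nonneg b_nonneg by (simp add: C_def)
  have lip: "(\<integral>\<^sup>+\<omega>. ennreal \<bar>X s \<omega> - X t \<omega>\<bar> \<partial>P) \<le> ennreal (C * dist s t)" for s t
  proof (cases "s = t")
    case False
    let ?q = "\<lambda>\<omega>. \<bar>X s \<omega> - X t \<omega>\<bar> / dist s t"
    let ?c = "dist s t * \<psi> 1"
    have "\<bar>X s \<omega> - X t \<omega>\<bar> \<le> ?c * (a + b * \<phi> (?q \<omega>))" for \<omega>
    proof -
      have "?q \<omega> / \<psi> 1 \<le> a + b * (\<phi> (?q \<omega>) / \<phi> (\<psi> 1))" by (rule growth_quotient) auto
      then have "?c * (?q \<omega> / \<psi> 1) \<le> ?c * (a + b * \<phi> (?q \<omega>))"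
        using \<psi>_1_pos by (intro mult_left_mono) (auto simp: \<phi>_\<psi>)
      then show ?thesis using False \<psi>_1_pos by simp
    qed
    then have "(\<integral>\<^sup>+\<omega>. ennreal \<bar>X s \<omega> - X t \<omega>\<bar> \<partial>P)
        \<le> (\<integral>\<^sup>+\<omega>. ennreal ?c * (ennreal a + ennreal b * ennreal (\<phi> (?q \<omega>))) \<partial>P)"
      using a_nonneg b_nonneg \<psi>_1_pos \<phi>_nonneg
      by (intro nn_integral_mono)
        (auto simp: ennreal_mult'[symmetric] ennreal_plus[symmetric] simp del: ennreal_plus intro!: ennreal_leI)
    also have "\<dots> = ennreal ?c * (ennreal a + ennreal b * (\<integral>\<^sup>+\<omega>. ennreal (\<phi> (?q \<omega>)) \<partial>P))"
      by (simp add: nn_integral_cmult nn_integral_add P.emeasure_space_1)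
    also have "\<dots> \<le> ennreal ?c * (ennreal a + ennreal b * 1)"
      by (intro mult_left_mono add_left_mono young zero_le)
    also have "\<dots> = ennreal (C * dist s t)"
      using a_nonneg b_nonneg \<psi>_1_pos
      by (simp add: C_def ennreal_mult'[symmetric] ennreal_plus[symmetric] mult_ac del: ennreal_plus)
    finally show ?thesis .
  qed simp
  obtain Y where Y: "(\<lambda>p. Y (fst p) (snd p)) \<in> borel_measurable (borel \<Otimes>\<^sub>M P)"
    and YX: "\<And>t. AE \<omega> in P. Y t \<omega> = X t \<omega>"
    using jointly_measurable_modification[OF dense X lip C] by blast
  have Y_lip: "(\<integral>\<^sup>+\<omega>. ennreal \<bar>Y s \<omega> - Y t \<omega>\<bar> \<partial>P) \<le> ennreal (C * dist s t)" for s t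
  proof -
    have "(\<integral>\<^sup>+\<omega>. ennreal \<bar>Y s \<omega> - Y t \<omega>\<bar> \<partial>P) = (\<integral>\<^sup>+\<omega>. ennreal \<bar>X s \<omega> - X t \<omega>\<bar> \<partial>P)"
      using YX[of s] YX[of t] by (intro nn_integral_cong_AE) auto
    then show ?thesis using lip by simp
  qed
  have Y_young: "(\<integral>\<^sup>+\<omega>. ennreal (\<phi> (\<bar>Y s \<omega> - Y t \<omega>\<bar> / dist s t)) \<partial>P) \<le> 1" for s t
  proof -
    have "(\<integral>\<^sup>+\<omega>. ennreal (\<phi> (\<bar>Y s \<omega> - Y t \<omega>\<bar> / dist s t)) \<partial>P)
        = (\<integral>\<^sup>+\<omega>. ennreal (\<phi> (\<bar>X s \<omega> - X t \<omega>\<bar> / dist s t)) \<partial>P)"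
      using YX[of s] YX[of t] by (intro nn_integral_cong_AE) auto
    then show ?thesis using young by simp
  qed
  let ?A = "ennreal a * const_A R * mm_sup \<phi> m" and ?B = "ennreal b * (const_B R * mm_mean \<phi> m)"
  have "(\<integral>\<^sup>+\<omega>. (SUP s\<in>F. SUP t\<in>F. ennreal \<bar>X s \<omega> - X t \<omega>\<bar>) \<partial>P) \<le> 2 * (?A + ?B + 0)"
    if F: "finite F" for F
  \<comment> \<open>The left side does not depend on n, so n can grow; the remainder vanishes since
    \<open>r n s\<close> tends to 0 at each of finitely many s.\<close>
  proof (rule LIMSEQ_le_const)
    have "(\<lambda>n. \<Sum>s\<in>F. C * r n s) \<longlonglongrightarrow> (\<Sum>s\<in>F. C * 0)"
      by (intro tendsto_intros r_tendsto_0)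
    then have "(\<lambda>n. ennreal (\<Sum>s\<in>F. C * r n s)) \<longlonglongrightarrow> ennreal (\<Sum>s\<in>F. C * 0)"
      by (rule tendsto_ennrealI)
    then have "(\<lambda>n. \<Sum>s\<in>F. ennreal (C * r n s)) \<longlonglongrightarrow> 0"
      using C r_nonneg by (simp add: sum_ennreal)
    then show "(\<lambda>n. 2 * (?A + ?B + (\<Sum>s\<in>F. ennreal (C * r n s)))) \<longlonglongrightarrow> 2 * (?A + ?B + 0)"
      by (intro ennreal_tendsto_cmult tendsto_add tendsto_const) auto
    \<comment> \<open>Each s has its own null set; finiteness of F gives a common one.\<close>
    have AE: "AE \<omega> in P. \<forall>s\<in>F. Y s \<omega> = X s \<omega>"
      using F YX by (intro AE_finite_allI) auto
    have "(\<integral>\<^sup>+\<omega>. (SUP s\<in>F. SUP t\<in>F. ennreal \<bar>X s \<omega> - X t \<omega>\<bar>) \<partial>P) \<le> 2 * (?A + ?B + (\<Sum>s\<in>F. ennreal (C * r n s)))" for n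
    proof -
      have "(\<integral>\<^sup>+\<omega>. (SUP s\<in>F. SUP t\<in>F. ennreal \<bar>X s \<omega> - X t \<omega>\<bar>) \<partial>P)
          = (\<integral>\<^sup>+\<omega>. (SUP s\<in>F. SUP t\<in>F. ennreal \<bar>Y s \<omega> - Y t \<omega>\<bar>) \<partial>P)"
        using AE by (intro nn_integral_cong_AE) (auto elim!: eventually_mono intro!: SUP_cong)
      also have "\<dots> \<le> 2 * (?A + (\<Sum>k<n. ennreal (b * y (Suc k)) * (\<integral>\<^sup>+x. ennreal (r k x) \<partial>m)) + (\<Sum>s\<in>F. ennreal (C * r n s)))"
        by (rule expected_sup_finite_le[OF P Y F C Y_lip Y_young maj_le_mm_sup])
      also have "(\<Sum>k<n. ennreal (b * y (Suc k)) * (\<integral>\<^sup>+x. ennreal (r k x) \<partial>m))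
          = ennreal b * (\<Sum>k<n. ennreal (y (Suc k)) * (\<integral>\<^sup>+x. ennreal (r k x) \<partial>m))"
        using b_nonneg by (simp add: sum_distrib_left ennreal_mult' mult.assoc)
      also have "2 * (?A + \<dots> + (\<Sum>s\<in>F. ennreal (C * r n s))) \<le> 2 * (?A + ?B + (\<Sum>s\<in>F. ennreal (C * r n s)))"
        by (intro mult_left_mono add_mono sum_integral_r_le order_refl zero_le)
      finally show ?thesis .
    qed
    then show "\<exists>N. \<forall>n\<ge>N. (\<integral>\<^sup>+\<omega>. (SUP s\<in>F. SUP t\<in>F. ennreal \<bar>X s \<omega> - X t \<omega>\<bar>) \<partial>P)
        \<le> 2 * (?A + ?B + (\<Sum>s\<in>F. ennreal (C * r n s)))" by blast
  qed
  then have "expected_sup_increment P X \<le> 2 * (?A + ?B + 0)"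
    unfolding expected_sup_increment_def by (auto intro!: SUP_least)
  then show ?thesis by (simp add: distrib_left mult.assoc)
qed

end

section \<open>A dense sequence from separability, and the case distinction on the diameter\<close>

lemma separable_process_dense:
  fixes X :: "'t::metric_space \<Rightarrow> 'w \<Rightarrow> real"
  assumes "prob_space P" and "separable_process P X"
  obtains q :: "nat \<Rightarrow> 't" where "\<And>t \<epsilon>. 0 < \<epsilon> \<Longrightarrow> \<exists>i. dist t (q i) < \<epsilon>"
proof -
  interpret prob_space P by fact
  obtain S where S: "countable S"
    and AE: "AE \<omega> in P. \<forall>t. \<forall>\<epsilon>>0. X t \<omega> \<in> closure ((\<lambda>s. X s \<omega>) ` (S \<inter> ball t \<epsilon>))"
    using assms(2) unfolding separable_process_def by blast
  have "\<exists>\<omega>. \<forall>t. \<forall>\<epsilon>>0. X t \<omega> \<in> closure ((\<lambda>s. X s \<omega>) ` (S \<inter> ball t \<epsilon>))"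
    by (rule eventually_happens'[OF ae_filter_bot AE])
  \<comment> \<open>One good path suffices: the closure of an empty image is empty, so S meets every
    ball. Separability of the process thus forces that of the space.\<close>
  then have ne: "S \<inter> ball t \<epsilon> \<noteq> {}" if "0 < \<epsilon>" for t \<epsilon>
    using that by (metis closure_empty empty_iff image_empty)
  have "\<exists>i. dist t (from_nat_into S i) < \<epsilon>" if "0 < \<epsilon>" for t \<epsilon>
  proof -
    obtain s where "s \<in> S" "dist t s < \<epsilon>" using ne[OF \<open>0 < \<epsilon>\<close>, of t] by auto
    then show ?thesis using from_nat_into_surj[OF S] by metis
  qed
  then show ?thesis by (rule that)
qed

lemma emeasure_lborel_greaterThan: "emeasure lborel {c::real<..} = \<infinity>"
proof (rule ccontr)
  assume "emeasure lborel {c<..} \<noteq> \<infinity>"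
  then obtain z where z: "0 \<le> z" "emeasure lborel {c<..} = ennreal z"
    by (cases "emeasure lborel {c<..}") auto
  have "ennreal (z + 1) = emeasure lborel {c<..<c + (z + 1)}" using z by simp
  also have "\<dots> \<le> ennreal z" unfolding z(2)[symmetric] by (intro emeasure_mono) auto
  finally show False using z by simp
qed

theorem theorem3p1:
  fixes m :: "'t::metric_space measure"
    and P :: "'w measure"
    and X :: "'t \<Rightarrow> 'w \<Rightarrow> real"
    and \<phi> :: "real \<Rightarrow> real"
    and a b R :: real
  assumes "prob_space m" and "sets m = sets borel" and "msupport m = UNIV"
    and "a \<ge> 0" and "b \<ge> 0"
    and "\<phi> \<in> G_class a b" and "young_function \<phi>"
    and "R \<ge> 2"
    and "prob_space P" and "\<And>t. X t \<in> borel_measurable P"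
    and "separable_process P X"
    and "(SUP s. SUP t. \<integral>\<^sup>+\<omega>. ennreal (\<phi> (\<bar>X s \<omega> - X t \<omega>\<bar> / dist s t)) \<partial>P) \<le> 1"
  shows "expected_sup_increment P X
           \<le> 2 * ennreal a * const_A R * mm_sup \<phi> m + 2 * ennreal b * const_B R * mm_mean \<phi> m"
proof -
  interpret growth_function \<phi> a b by unfold_locales fact
  interpret m: prob_space m by fact
  have "0 < b" using b_nonzero \<open>b \<ge> 0\<close> by simp
  obtain q :: "nat \<Rightarrow> 't" where dense: "\<And>t \<epsilon>. 0 < \<epsilon> \<Longrightarrow> \<exists>i. dist t (q i) < \<epsilon>"
    using separable_process_dense[OF \<open>prob_space P\<close> \<open>separable_process P X\<close>] by blast
  have young: "(\<integral>\<^sup>+\<omega>. ennreal (\<phi> (\<bar>X s \<omega> - X t \<omega>\<bar> / dist s t)) \<partial>P) \<le> 1" for s t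
    using assms(12) by (auto simp: SUP_le_iff)
  consider "ediam (UNIV :: 't set) = \<infinity>" | "ediam (UNIV :: 't set) = 0"
    | D where "0 < D" "ediam (UNIV :: 't set) = ennreal D"
    by (cases "ediam (UNIV :: 't set)") (auto simp: less_le)
  then show ?thesis
  proof cases
    case 1
    \<comment> \<open>The integrand is at least \<open>\<psi> 1 > 0\<close> on the whole half-line,
      so the mean is infinite, and b > 0 makes the right side infinite.\<close>
    have "mm_sigma \<phi> m x = \<infinity>" for x
    proof -
      have "\<infinity> = (\<integral>\<^sup>+e. ennreal (\<psi> 1) * indicator {0::real<..} e \<partial>lborel)"
        using \<psi>_1_pos by (subst nn_integral_cmult_indicator) (auto simp: ennreal_mult_top emeasure_lborel_greaterThan)
      also have "\<dots> \<le> mm_sigma \<phi> m x"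
        unfolding mm_sigma_def
      proof (intro nn_integral_mono)
        fix e :: real
        have "\<psi> 1 \<le> \<psi> (1 / measure m (cball x e))" if "0 < e"
          using measure_cball_pos_if_support[OF m.finite_measure_axioms assms(2,3) that, of x]
          by (intro \<psi>_mono) auto
        then show "ennreal (\<psi> 1) * indicator {0<..} e \<le> ennreal (\<psi> (1 / measure m (cball x e))) *
            indicator {\<epsilon>. 0 < \<epsilon> \<and> ennreal \<epsilon> < ediam (UNIV :: 't set)} e"
          using 1 by (auto simp: indicator_def ennreal_leI)
      qed
      finally show ?thesis by (simp add: top_unique)
    qed
    then have "mm_sigma \<phi> m = (\<lambda>x. \<infinity>)" by (intro ext)
    then have "mm_mean \<phi> m = \<infinity>" unfolding mm_mean_def by (simp add: m.emeasure_space_1)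
    moreover have "2 * ennreal b * const_B R \<noteq> 0"
      using \<open>0 < b\<close> \<open>R \<ge> 2\<close> by (simp add: const_B_def)
    ultimately show ?thesis by (simp add: ennreal_mult_top)
  next
    case 2
    \<comment> \<open>The index space is a single point, so all increments vanish.\<close>
    then have "ennreal (dist s t) \<le> 0" for s t :: 't
      unfolding ediam_def by (metis SUP_upper2 UNIV_I order_refl)
    then have "s = t" for s t :: 't by (metis dist_le_zero_iff ennreal_eq_0_iff le_zero_eq)
    then have "ennreal \<bar>X s \<omega> - X t \<omega>\<bar> = 0" for s t \<omega> by (metis abs_zero diff_self ennreal_0)
    then have "(SUP s\<in>F. SUP t\<in>F. ennreal \<bar>X s \<omega> - X t \<omega>\<bar>) \<le> 0" for F \<omega>
      by (intro SUP_least) (simp only: order_refl)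
    then have "expected_sup_increment P X \<le> 0"
      unfolding expected_sup_increment_def by (intro SUP_least) simp
    then show ?thesis by simp
  next
    case (3 D)
    interpret majorizing_measure \<phi> a b m R D q
      by unfold_locales (fact assms 3 dense)+
    show ?thesis by (rule expected_sup_increment_le[OF \<open>prob_space P\<close> assms(10) young])
  qed
qed

end
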